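(* Let $G=(X,E)$ be a connected $P_4$-free graph of any cardinality. Then there exists $x\in X$ such that $N_x\neq\emptyset$ if and only if the complement graph $\overline{G}$ is not connected.
   Context: Graphs are undirected, simple, without loops, and not necessarily finite: $G=(X,E)$ with $E\subseteq [X]^2$, the set of $2$-element subsets of $X$. The complement $\overline{G}$ has vertex set $X$ and edge set $[X]^2\setminus E$. $P_4$ is the path on four vertices $1,2,3,4$ with edges $\{1,2\},\{2,3\},\{3,4\}$; a graph is $P_4$-free if it has no induced subgraph isomorphic to $P_4$. For $x\in X$, let $N(x):=\{y\in X:\{x,y\}\in E\}$ and $\mathrm{inc}(x):=X\setminus(N(x)\cup\{x\})$, and define $$N_x:=\{y\in N(x): y\text{ is adjacent to all elements of }\mathrm{inc}(x)\}.$$ *)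

theory Defs
  imports "HOL-Library.Ramsey"
begin

text \<open>A graph is given by its vertex set \<open>X\<close>, of any cardinality, and its edge set
  \<open>E\<close>, a set of 2-element subsets of \<open>X\<close>. The set of 2-element subsets is \<open>nsets X 2\<close>,
  written \<open>[X]\<^bsup>2\<^esup>\<close>, from the Ramsey theory.\<close>

definition simple_graph :: "'a set \<Rightarrow> 'a set set \<Rightarrow> bool" where
  "simple_graph X E \<longleftrightarrow> E \<subseteq> [X]\<^bsup>2\<^esup>"

definition complement_edges :: "'a set \<Rightarrow> 'a set set \<Rightarrow> 'a set set" where
  "complement_edges X E = [X]\<^bsup>2\<^esup> - E"

text \<open>Any two vertices are joined by a finite path. The graph without vertices
  counts as connected, and so does its complement.\<close>

definition connected_graph :: "'a set \<Rightarrow> 'a set set \<Rightarrow> bool" where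
  "connected_graph X E \<longleftrightarrow> (\<forall>x\<in>X. \<forall>y\<in>X. (x, y) \<in> {(u, v). {u, v} \<in> E}\<^sup>*)"

definition induced_edges :: "'a set set \<Rightarrow> 'a set \<Rightarrow> 'a set set" where
  "induced_edges E A = E \<inter> [A]\<^bsup>2\<^esup>"

definition graph_isomorphic ::
  "'a set \<Rightarrow> 'a set set \<Rightarrow> 'b set \<Rightarrow> 'b set set \<Rightarrow> bool" where
  "graph_isomorphic X E Y F \<longleftrightarrow>
    (\<exists>f. bij_betw f X Y \<and> (\<forall>x\<in>X. \<forall>y\<in>X. {x, y} \<in> E \<longleftrightarrow> {f x, f y} \<in> F))"

definition P4_vertices :: "nat set" where
  "P4_vertices = {1, 2, 3, 4}"

definition P4_edges :: "nat set set" where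
  "P4_edges = {{1, 2}, {2, 3}, {3, 4}}"

definition P4_free :: "'a set \<Rightarrow> 'a set set \<Rightarrow> bool" where
  "P4_free X E \<longleftrightarrow>
    \<not> (\<exists>A\<subseteq>X. graph_isomorphic A (induced_edges E A) P4_vertices P4_edges)"

definition neighbours :: "'a set \<Rightarrow> 'a set set \<Rightarrow> 'a \<Rightarrow> 'a set" where
  "neighbours X E x = {y \<in> X. {x, y} \<in> E}"

definition inc :: "'a set \<Rightarrow> 'a set set \<Rightarrow> 'a \<Rightarrow> 'a set" where
  "inc X E x = X - (neighbours X E x \<union> {x})"

text \<open>The set \<open>N\<^sub>x\<close> of the neighbours of \<open>x\<close> adjacent to every non-neighbour of \<open>x\<close>
  other than \<open>x\<close>.\<close>

definition N_sub :: "'a set \<Rightarrow> 'a set set \<Rightarrow> 'a \<Rightarrow> 'a set" where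
  "N_sub X E x = {y \<in> neighbours X E x. \<forall>z\<in>inc X E x. {y, z} \<in> E}"

end

(* Two vertices of a P4-free graph that are joined by a path have distance at most 2, and the
   complement of P4 is again P4. If y lies in N_x, then x and y are neither adjacent in the
   complement nor have a common neighbour there, so no path of the complement joins them.
   Conversely, if u and v lie in different components of the complement, then every
   non-neighbour of u lies in the component of u, hence is adjacent to v; so v lies in N_u. *)

theory Submission imports Defs begin

lemma doubleton_in_nsets_2_iff: "{x, y} \<in> [X]\<^bsup>2\<^esup> \<longleftrightarrow> x \<in> X \<and> y \<in> X \<and> x \<noteq> y"
  by (auto simp: nsets_def card_insert_if)

lemma complement_edges_iff:
  "{x, y} \<in> complement_edges X E \<longleftrightarrow> x \<in> X \<and> y \<in> X \<and> x \<noteq> y \<and> {x, y} \<notin> E"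
  by (auto simp: complement_edges_def doubleton_in_nsets_2_iff)

text \<open>Sending the four vertices in order to 1, 2, 3, 4 gives the isomorphism that
  \<open>P4_free\<close> forbids, so later only three edges and three non-edges need to be
  listed.\<close>

lemma P4_free_no_induced_path:
  assumes "P4_free X E"
    and X: "a \<in> X" "b \<in> X" "c \<in> X" "d \<in> X"
    and dist: "distinct [a, b, c, d]"
    and edges: "{a, b} \<in> E" "{b, c} \<in> E" "{c, d} \<in> E"
    and nonedges: "{a, c} \<notin> E" "{a, d} \<notin> E" "{b, d} \<notin> E"
  shows False
proof -
  let ?A = "{a, b, c, d}"
  define f where "f z = (if z = a then 1 else if z = b then 2 else if z = c then 3 else 4::nat)" for z
  have f: "f a = 1" "f b = 2" "f c = 3" "f d = 4"
    using dist by (auto simp: f_def)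
  have "bij_betw f ?A P4_vertices"
    using f by (auto simp: bij_betw_def inj_on_def P4_vertices_def)
  moreover have "{x, y} \<in> induced_edges E ?A \<longleftrightarrow> {f x, f y} \<in> P4_edges"
    if "x \<in> ?A" "y \<in> ?A" for x y
  proof -
    have "{b, a} \<in> E" "{c, b} \<in> E" "{d, c} \<in> E" "{c, a} \<notin> E" "{d, a} \<notin> E" "{d, b} \<notin> E"
      using edges nonedges by (simp_all add: insert_commute)
    \<comment> \<open>\<open>E\<close> may contain singletons here; \<open>induced_edges\<close>
      discards them, which matches \<open>P4_edges\<close> when \<open>x = y\<close>.\<close>
    moreover have "{x, y} \<in> induced_edges E ?A \<longleftrightarrow> {x, y} \<in> E \<and> x \<noteq> y"
      using that by (auto simp: induced_edges_def doubleton_in_nsets_2_iff)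
    ultimately show ?thesis
      using that dist edges nonedges f by (auto simp: P4_edges_def doubleton_eq_iff)
  qed
  ultimately have "graph_isomorphic ?A (induced_edges E ?A) P4_vertices P4_edges"
    unfolding graph_isomorphic_def by blast
  moreover have "?A \<subseteq> X"
    using X by simp
  ultimately show False
    using \<open>P4_free X E\<close> unfolding P4_free_def by blast
qed

text \<open>Induction along the path: the first step to distance 3 would create an induced path on
  four vertices in the complement, hence one in the graph.\<close>

lemma P4_free_complement_distance_le_2:
  assumes "P4_free X E"
    and "(x, y) \<in> {(u, v). {u, v} \<in> complement_edges X E}\<^sup>*"
  shows "x = y \<or> {x, y} \<in> complement_edges X E \<or>
    (\<exists>z. {x, z} \<in> complement_edges X E \<and> {z, y} \<in> complement_edges X E)"
  using assms(2)
proof (induction rule: rtrancl_induct)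
  case base
  then show ?case by simp
next
  case (step y w)
  let ?C = "complement_edges X E"
  have yw: "{y, w} \<in> ?C"
    using step.hyps by simp
  show ?case
  proof (rule ccontr)
    assume far: "\<not> ?thesis"
    \<comment> \<open>If \<open>y\<close> were \<open>x\<close> or adjacent to \<open>x\<close> in
      \<open>?C\<close>, then \<open>w\<close> would be within distance 2, so only the third case of
      the induction hypothesis remains.\<close>
    with step.IH yw obtain z where xz: "{x, z} \<in> ?C" and zy: "{z, y} \<in> ?C"
      by blast
    \<comment> \<open>Each failure would shorten the walk \<open>x, z, y, w\<close> to length at
      most 2, against \<open>far\<close>.\<close>
    have "x \<noteq> w" "{x, w} \<notin> ?C" "{x, y} \<notin> ?C" "{z, w} \<notin> ?C" "x \<noteq> y" "z \<noteq> w"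
      using far xz yw by auto
    \<comment> \<open>The complement of the path \<open>x, z, y, w\<close> is the path \<open>z, w, x, y\<close>.\<close>
    with xz zy yw show False
      using P4_free_no_induced_path[OF assms(1), of z w x y]
      by (auto simp: complement_edges_iff insert_commute)
  qed
qed

theorem theorem2:
  fixes X :: "'a set" and E :: "'a set set"
  assumes "simple_graph X E"
    and "connected_graph X E"
    and "P4_free X E"
  shows "(\<exists>x\<in>X. N_sub X E x \<noteq> {}) \<longleftrightarrow> \<not> connected_graph X (complement_edges X E)"
proof
  let ?C = "complement_edges X E"
  assume "\<exists>x\<in>X. N_sub X E x \<noteq> {}"
  then obtain x y where "x \<in> X" "y \<in> X" and xy: "{x, y} \<in> E"
    and N: "\<forall>z\<in>inc X E x. {y, z} \<in> E"
    by (auto simp: N_sub_def neighbours_def)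
  \<comment> \<open>The next three facts exclude distances 0, 1 and 2 in the complement; for
    distance 2, a midpoint \<open>z\<close> would lie in \<open>inc X E x\<close>, so
    \<open>y\<close> is adjacent to it in \<open>E\<close>.\<close>
  have "x \<noteq> y"
    using xy assms(1) doubleton_in_nsets_2_iff[of x y X] unfolding simple_graph_def by blast
  moreover have "{x, y} \<notin> ?C"
    using xy by (simp add: complement_edges_iff)
  moreover have "{z, y} \<notin> ?C" if "{x, z} \<in> ?C" for z
    using that N by (auto simp: complement_edges_iff inc_def neighbours_def insert_commute)
  ultimately have "(x, y) \<notin> {(u, v). {u, v} \<in> ?C}\<^sup>*"
    using P4_free_complement_distance_le_2[OF assms(3)] by blast
  then show "\<not> connected_graph X ?C"
    using \<open>x \<in> X\<close> \<open>y \<in> X\<close> by (auto simp: connected_graph_def)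
next
  let ?C = "complement_edges X E"
  let ?R = "{(u, v). {u, v} \<in> ?C}"
  assume "\<not> connected_graph X ?C"
  then obtain u v where "u \<in> X" "v \<in> X" and uv: "(u, v) \<notin> ?R\<^sup>*"
    by (auto simp: connected_graph_def)
  have "u \<noteq> v" "(u, v) \<notin> ?R"
    using uv by blast+
  then have "{u, v} \<in> E"
    using \<open>u \<in> X\<close> \<open>v \<in> X\<close> by (simp add: complement_edges_iff)
  moreover have "{v, z} \<in> E" if "z \<in> inc X E u" for z
  proof -
    have z: "z \<in> X" "z \<noteq> u" "{u, z} \<notin> E"
      using that by (auto simp: inc_def neighbours_def)
    then have "(u, z) \<in> ?R"
      using \<open>u \<in> X\<close> by (simp add: complement_edges_iff)
    with uv have "(z, v) \<notin> ?R"
      by (meson r_into_rtrancl rtrancl_into_rtrancl)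
    \<comment> \<open>Missing from \<open>?C\<close> means being an edge only for distinct
      vertices.\<close>
    moreover have "z \<noteq> v"
      using z \<open>{u, v} \<in> E\<close> by blast
    ultimately show ?thesis
      using z \<open>v \<in> X\<close> by (simp add: complement_edges_iff insert_commute)
  qed
  ultimately have "v \<in> N_sub X E u"
    using \<open>v \<in> X\<close> by (simp add: N_sub_def neighbours_def)
  then show "\<exists>x\<in>X. N_sub X E x \<noteq> {}"
    using \<open>u \<in> X\<close> by blast
qed

end
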